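(* There does not exist a minimal translation surface in the Galilean space $\mathbb{G}_3$ of the form $$r(u,v)=\bigl(u+v,\;f_1(u)+g(v),\;f_2(u)+av\bigr),$$ generated by translating a smooth space curve $\alpha(u)=(u,f_1(u),f_2(u))$ and a planar non-isotropic curve $\beta(v)=(v,g(v),av)$, $a\in\mathbb{R}$, $g$ smooth (both defined on open intervals).
   Context: The affine model of the Galilean 3-space $\mathbb{G}_3$ is $\mathbb{R}^3$ with coordinates $(x,y,z)$. A curve $\alpha(u)=(u,f_1(u),f_2(u))$ is a space curve if its torsion is nowhere zero, i.e. $f_1''f_2'''-f_1'''f_2''\neq 0$ at every $u$. Curvatures of a surface $r(u_1,u_2)=(x,y,z)$ (with $x_{,i}=\partial x/\partial u_i$, $x_{,ij}=\partial^2x/\partial u_i\partial u_j$, etc.): assume $x_{,i}\ne 0$ for some $i$ at each point (admissibility), and set $$W=\sqrt{(x_{,1}z_{,2}-x_{,2}z_{,1})^2+(x_{,2}y_{,1}-x_{,1}y_{,2})^2},\qquad N=\tfrac1W\bigl(0,\,-x_{,1}z_{,2}+x_{,2}z_{,1},\,x_{,1}y_{,2}-x_{,2}y_{,1}\bigr),$$ where surfaces are assumed regular, i.e. $W>0$ everywhere, and $$L_{ij}=\tfrac1{x_{,k}}\bigl(x_{,k}(0,y_{,ij},z_{,ij})-x_{,ij}(0,y_{,k},z_{,k})\bigr)\cdot N$$ for an index $k$ with $x_{,k}\neq 0$, where $\cdot$ is the Euclidean scalar product. The mean curvature is $H=(x_{,2}^2L_{11}-2x_{,1}x_{,2}L_{12}+x_{,1}^2L_{22})/(2W^2)$.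 A surface is minimal if $H$ vanishes identically. For the surface in the claim, $W^2=(f_2'-a)^2+(f_1'-g')^2$. *)

theory Defs
  imports "HOL-Analysis.Analysis"
begin

section \<open>Curves in the Galilean 3-space\<close>

text \<open>The affine model of the Galilean 3-space is \<^typ>\<open>real^3\<close>, with coordinates
  \<open>x = p $ 1\<close>, \<open>y = p $ 2\<close>, \<open>z = p $ 3\<close>.\<close>

definition smooth_on :: "real set \<Rightarrow> (real \<Rightarrow> real) \<Rightarrow> bool" where
  "smooth_on I f \<longleftrightarrow> (\<forall>n. \<forall>t\<in>I. (deriv ^^ n) f differentiable (at t))"
  \<comment> \<open>meant for open \<open>I\<close>, where it says that \<open>f\<close> is infinitely differentiable on \<open>I\<close>\<close>

definition open_interval :: "real set \<Rightarrow> bool" where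
  "open_interval I \<longleftrightarrow> is_interval I \<and> open I \<and> I \<noteq> {}"
  \<comment> \<open>possibly unbounded\<close>

definition space_curve :: "real set \<Rightarrow> (real \<Rightarrow> real^3) \<Rightarrow> bool" where
  "space_curve I \<alpha> \<longleftrightarrow>
     (\<forall>u\<in>I. \<alpha> u $ 1 = u) \<and>
     (\<forall>u\<in>I. (deriv ^^ 2) (\<lambda>t. \<alpha> t $ 2) u * (deriv ^^ 3) (\<lambda>t. \<alpha> t $ 3) u
           - (deriv ^^ 3) (\<lambda>t. \<alpha> t $ 2) u * (deriv ^^ 2) (\<lambda>t. \<alpha> t $ 3) u \<noteq> 0)"

definition planar_curve :: "real set \<Rightarrow> (real \<Rightarrow> real^3) \<Rightarrow> bool" where
  "planar_curve J \<beta> \<longleftrightarrow> (\<exists>n c. n \<noteq> 0 \<and> (\<forall>v\<in>J. n \<bullet> \<beta> v = c))"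

text \<open>A vector is isotropic in the Galilean sense iff its first coordinate vanishes.\<close>

definition non_isotropic_curve :: "real set \<Rightarrow> (real \<Rightarrow> real^3) \<Rightarrow> bool" where
  "non_isotropic_curve J \<beta> \<longleftrightarrow> (\<forall>v\<in>J. deriv (\<lambda>t. \<beta> t $ 1) v \<noteq> 0)"

section \<open>Surfaces in the Galilean 3-space\<close>

text \<open>A surface is given by a parametrization on (an open set of) \<^typ>\<open>real^2\<close>; the two
  elements of the index type \<^typ>\<open>2\<close> index the parameters.\<close>

definition partial :: "2 \<Rightarrow> (real^2 \<Rightarrow> real) \<Rightarrow> real^2 \<Rightarrow> real" where
  "partial i F p = deriv (\<lambda>t. F (p + t *\<^sub>R axis i 1)) 0"

text \<open>\<open>d1 r c i\<close> and \<open>d2 r c i j\<close> are the partial derivatives, of first and second order, of the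
  \<open>c\<close>-th coordinate of \<open>r\<close>; e.g. \<open>x\<^sub>,\<^sub>i\<close> is \<open>d1 r 1 i\<close> and \<open>z\<^sub>,\<^sub>i\<^sub>j\<close> is \<open>d2 r 3 i j\<close>.\<close>

definition d1 :: "(real^2 \<Rightarrow> real^3) \<Rightarrow> 3 \<Rightarrow> 2 \<Rightarrow> real^2 \<Rightarrow> real" where
  "d1 r c i = partial i (\<lambda>q. r q $ c)"

definition d2 :: "(real^2 \<Rightarrow> real^3) \<Rightarrow> 3 \<Rightarrow> 2 \<Rightarrow> 2 \<Rightarrow> real^2 \<Rightarrow> real" where
  "d2 r c i j = partial j (d1 r c i)"

definition surf_W :: "(real^2 \<Rightarrow> real^3) \<Rightarrow> real^2 \<Rightarrow> real" where
  "surf_W r p = sqrt ((d1 r 1 1 p * d1 r 3 2 p - d1 r 1 2 p * d1 r 3 1 p)\<^sup>2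
                    + (d1 r 1 2 p * d1 r 2 1 p - d1 r 1 1 p * d1 r 2 2 p)\<^sup>2)"

definition surf_N :: "(real^2 \<Rightarrow> real^3) \<Rightarrow> real^2 \<Rightarrow> real^3" where
  "surf_N r p = (1 / surf_W r p) *\<^sub>R
     vector [0,
             - d1 r 1 1 p * d1 r 3 2 p + d1 r 1 2 p * d1 r 3 1 p,
             d1 r 1 1 p * d1 r 2 2 p - d1 r 1 2 p * d1 r 2 1 p]"

definition surf_L_wrt :: "2 \<Rightarrow> (real^2 \<Rightarrow> real^3) \<Rightarrow> 2 \<Rightarrow> 2 \<Rightarrow> real^2 \<Rightarrow> real" where
  "surf_L_wrt k r i j p =
     ((1 / d1 r 1 k p) *\<^sub>R
       (d1 r 1 k p *\<^sub>R vector [0, d2 r 2 i j p, d2 r 3 i j p]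
        - d2 r 1 i j p *\<^sub>R vector [0, d1 r 2 k p, d1 r 3 k p])) \<bullet> surf_N r p"

text \<open>The coefficient does not depend on the index \<open>k\<close> with \<open>x\<^sub>,\<^sub>k \<noteq> 0\<close>.\<close>

lemma surf_L_wrt_indep:
  assumes "d1 r 1 k p \<noteq> 0" "d1 r 1 l p \<noteq> 0"
  shows "surf_L_wrt k r i j p = surf_L_wrt l r i j p"
proof -
  have key: "(1 / a) * (a * Y - X * b) * (w * B) + (1 / a) * (a * Z - X * c) * (w * C)
      = (1 / d) * (d * Y - X * e) * (w * B) + (1 / d) * (d * Z - X * f) * (w * C)"
    if "a \<noteq> 0" "d \<noteq> 0" and BC: "B = - a * f + d * c" "C = a * e - d * b"
    for a b c d e f w X Y Z B C :: real
  proof -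
    have aux: "(1 / s) * (s * Y - X * t) * (w * B) + (1 / s) * (s * Z - X * t') * (w * C)
             = w * (Y * B + Z * C - X * ((t * B + t' * C) / s))"
      if "s \<noteq> 0" for s t t'
      using that by (simp add: field_simps)
    have "b * B + c * C = a * (c * e - b * f)" "e * B + f * C = d * (c * e - b * f)"
      unfolding BC by (simp_all add: algebra_simps)
    then show ?thesis
      using that(1,2) unfolding aux[OF that(1)] aux[OF that(2)] by simp
  qed
  have "surf_L_wrt 1 r i j p = surf_L_wrt 2 r i j p"
    if x: "d1 r 1 1 p \<noteq> 0" "d1 r 1 2 p \<noteq> 0"
    using key[OF x refl refl, of "d2 r 2 i j p" "d2 r 1 i j p" "d1 r 2 1 p" "1 / surf_W r p"
        "d1 r 3 2 p" "d1 r 3 1 p" "d2 r 3 i j p" "d1 r 2 2 p"]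
    by (simp add: surf_L_wrt_def surf_N_def inner_vec_def sum_3)
  moreover have "(k = 1 \<or> k = 2) \<and> (l = 1 \<or> l = 2)"
    using exhaust_2 by blast
  ultimately show ?thesis
    using assms by auto
qed

definition surf_L :: "(real^2 \<Rightarrow> real^3) \<Rightarrow> 2 \<Rightarrow> 2 \<Rightarrow> real^2 \<Rightarrow> real" where
  "surf_L r i j p = surf_L_wrt (SOME k. d1 r 1 k p \<noteq> 0) r i j p"

definition mean_curvature :: "(real^2 \<Rightarrow> real^3) \<Rightarrow> real^2 \<Rightarrow> real" where
  "mean_curvature r p =
     ((d1 r 1 2 p)\<^sup>2 * surf_L r 1 1 p
      - 2 * d1 r 1 1 p * d1 r 1 2 p * surf_L r 1 2 p
      + (d1 r 1 1 p)\<^sup>2 * surf_L r 2 2 p) / (2 * (surf_W r p)\<^sup>2)"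

definition admissible_on :: "(real^2) set \<Rightarrow> (real^2 \<Rightarrow> real^3) \<Rightarrow> bool" where
  "admissible_on D r \<longleftrightarrow> (\<forall>p\<in>D. \<exists>i. d1 r 1 i p \<noteq> 0)"

definition regular_on :: "(real^2) set \<Rightarrow> (real^2 \<Rightarrow> real^3) \<Rightarrow> bool" where
  "regular_on D r \<longleftrightarrow> (\<forall>p\<in>D. surf_W r p > 0)"

definition minimal_on :: "(real^2) set \<Rightarrow> (real^2 \<Rightarrow> real^3) \<Rightarrow> bool" where
  "minimal_on D r \<longleftrightarrow> (\<forall>p\<in>D. mean_curvature r p = 0)"

section \<open>Translation surfaces\<close>

definition translation_surface ::
    "(real \<Rightarrow> real^3) \<Rightarrow> (real \<Rightarrow> real^3) \<Rightarrow> real^2 \<Rightarrow> real^3" where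
  "translation_surface \<alpha> \<beta> p = \<alpha> (p $ 1) + \<beta> (p $ 2)"

lemma translation_surface_explicit:
  "translation_surface (\<lambda>u. vector [u, f1 u, f2 u]) (\<lambda>v. vector [v, g v, a * v]) =
     (\<lambda>p. vector [p $ 1 + p $ 2, f1 (p $ 1) + g (p $ 2), f2 (p $ 1) + a * p $ 2])"
  by (simp add: fun_eq_iff translation_surface_def vec_eq_iff forall_3)

text \<open>Curves \<open>(v, g(v), a v)\<close> are automatically planar and non-isotropic.\<close>

lemma planar_curve_graph: "planar_curve J (\<lambda>v. vector [v, g v, a * v])"
proof -
  have "(vector [a, 0, -1] :: real^3) \<noteq> 0"
    by (simp add: vec_eq_iff forall_3)
  moreover have "\<forall>v\<in>J. (vector [a, 0, -1] :: real^3) \<bullet> vector [v, g v, a * v] = 0"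
    by (simp add: inner_vec_def sum_3)
  ultimately show ?thesis
    unfolding planar_curve_def by blast
qed

lemma non_isotropic_curve_graph: "non_isotropic_curve J (\<lambda>v. vector [v, g v, a * v])"
  by (simp add: non_isotropic_curve_def)

end

theory Submission
  imports Defs
begin

text \<open>With \<open>F = f1'\<close>, \<open>P = f2' - a\<close> and \<open>G = g'\<close>, minimality reads
  \<open>(F' + G') P = P' (F - G)\<close>, where \<open>F\<close>, \<open>P\<close> depend on \<open>u\<close> and \<open>G\<close> on \<open>v\<close> only.
  Eliminating \<open>G'\<close> between this equation and its \<open>u\<close>-derivative leaves an equation
  \<open>(P P'' - P'\<^sup>2) G = (function of u)\<close>. If the factor is nonzero at some \<open>u\<close>, then \<open>G\<close> is
  constant, and both \<open>(F', P')\<close> and \<open>(F'', P'')\<close> are orthogonal to \<open>(P, G - F)\<close>, which is nonzero by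
  regularity. If \<open>P P'' = P'\<^sup>2\<close> identically, then either \<open>P\<close> vanishes identically or, at a point where
  it does not, both pairs satisfy \<open>P (F'', P'') = P' (F', P')\<close>. In all cases the torsion
  determinant \<open>F' P'' - F'' P'\<close> vanishes somewhere.\<close>

text \<open>No differentiability is needed: \<^const>\<open>deriv\<close> is a choice from the set of all
  derivatives, and this set is unchanged by shifts and by adding constants.\<close>

lemma deriv_shift_add_const:
  fixes h :: "real \<Rightarrow> real"
  shows "deriv (\<lambda>t. h (x + t) + c) 0 = deriv h x"
proof -
  have "((\<lambda>t. h (x + t) + c) has_field_derivative D) (at 0) \<longleftrightarrow> (h has_field_derivative D) (at x)"
    for D
  proof -
    have "((\<lambda>t. h (x + t) + c) has_field_derivative D) (at 0)
        \<longleftrightarrow> ((\<lambda>t. h (x + t)) has_field_derivative D) (at 0)"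
    proof
      assume "((\<lambda>t. h (x + t) + c) has_field_derivative D) (at 0)"
      from DERIV_diff[OF this DERIV_const[of c]]
      show "((\<lambda>t. h (x + t)) has_field_derivative D) (at 0)" by simp
    next
      assume "((\<lambda>t. h (x + t)) has_field_derivative D) (at 0)"
      from DERIV_add[OF this DERIV_const[of c]]
      show "((\<lambda>t. h (x + t) + c) has_field_derivative D) (at 0)" by simp
    qed
    also have "\<dots> \<longleftrightarrow> (h has_field_derivative D) (at x)"
      using DERIV_shift[of h D 0 x] by (simp add: add.commute)
    finally show ?thesis .
  qed
  then show ?thesis
    by (simp add: deriv_def)
qed

text \<open>Each coordinate of a translation surface is such a sum; along one parameter direction
  the other summand is the constant \<open>c\<close> of
  \<open>deriv_shift_add_const\<close>.\<close>

lemma partial_separated: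
  "partial 1 (\<lambda>q. h (q $ 1) + k (q $ 2)) = (\<lambda>q. deriv h (q $ 1))"
  "partial 2 (\<lambda>q. h (q $ 1) + k (q $ 2)) = (\<lambda>q. deriv k (q $ 2))"
proof -
  show "partial 1 (\<lambda>q. h (q $ 1) + k (q $ 2)) = (\<lambda>q. deriv h (q $ 1))"
    by (simp add: fun_eq_iff partial_def axis_def deriv_shift_add_const[of h])
  have "deriv (\<lambda>t. h c + k (x + t)) 0 = deriv k x" for c x
    using deriv_shift_add_const[of k x "h c"] by (simp add: add.commute)
  then show "partial 2 (\<lambda>q. h (q $ 1) + k (q $ 2)) = (\<lambda>q. deriv k (q $ 2))"
    by (simp add: fun_eq_iff partial_def axis_def)
qed

lemma partial_single:
  "partial 1 (\<lambda>q. h (q $ 1)) = (\<lambda>q. deriv h (q $ 1))"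
  "partial 2 (\<lambda>q. h (q $ 1)) = (\<lambda>q. 0)"
  "partial 1 (\<lambda>q. h (q $ 2)) = (\<lambda>q. 0)"
  "partial 2 (\<lambda>q. h (q $ 2)) = (\<lambda>q. deriv h (q $ 2))"
  using partial_separated[of h "\<lambda>_. 0"] partial_separated[of "\<lambda>_. 0" h] by simp_all

context
  fixes f1 f2 g1 g2 :: "real \<Rightarrow> real" and r :: "real^2 \<Rightarrow> real^3"
  defines "r \<equiv> translation_surface (\<lambda>u. vector [u, f1 u, f2 u]) (\<lambda>v. vector [v, g1 v, g2 v])"
begin

lemma d1_translation_graphs:
  "d1 r 1 1 = (\<lambda>q. 1)" "d1 r 1 2 = (\<lambda>q. 1)"
  "d1 r 2 1 = (\<lambda>q. deriv f1 (q $ 1))" "d1 r 2 2 = (\<lambda>q. deriv g1 (q $ 2))"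
  "d1 r 3 1 = (\<lambda>q. deriv f2 (q $ 1))" "d1 r 3 2 = (\<lambda>q. deriv g2 (q $ 2))"
  using partial_separated[of "\<lambda>x. x" "\<lambda>x. x"] partial_separated[of f1 g1] partial_separated[of f2 g2]
  by (simp_all add: d1_def r_def translation_surface_def)

lemma d2_translation_graphs:
  "d2 r 1 i j = (\<lambda>q. 0)"
  "d2 r 2 1 1 = (\<lambda>q. deriv (deriv f1) (q $ 1))" "d2 r 3 1 1 = (\<lambda>q. deriv (deriv f2) (q $ 1))"
  "d2 r 2 1 2 = (\<lambda>q. 0)" "d2 r 3 1 2 = (\<lambda>q. 0)"
  "d2 r 2 2 2 = (\<lambda>q. deriv (deriv g1) (q $ 2))" "d2 r 3 2 2 = (\<lambda>q. deriv (deriv g2) (q $ 2))"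
proof -
  show "d2 r 1 i j = (\<lambda>q. 0)"
    using exhaust_2[of i] by (auto simp: d2_def d1_translation_graphs partial_def)
qed (simp_all add: d2_def d1_translation_graphs partial_single)

lemma surf_W_translation_graphs:
  "surf_W r p = sqrt ((deriv f2 (p $ 1) - deriv g2 (p $ 2))\<^sup>2 + (deriv f1 (p $ 1) - deriv g1 (p $ 2))\<^sup>2)"
  by (simp add: surf_W_def d1_translation_graphs power2_commute[of "deriv g2 (p $ 2)"])

text \<open>Here \<open>x\<close> has first partials 1 and second partials 0, and the mixed
  \<open>L\<close> coefficient vanishes, so the numerator of H is the sum of the two diagonal
  coefficients. The cube is one W from the normal and two from H; where W = 0, both sides are
  0.\<close>

lemma mean_curvature_translation_graphs:
  "mean_curvature r p =
     ((deriv (deriv f1) (p $ 1) + deriv (deriv g1) (p $ 2)) * (deriv f2 (p $ 1) - deriv g2 (p $ 2))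
      - (deriv (deriv f2) (p $ 1) + deriv (deriv g2) (p $ 2)) * (deriv f1 (p $ 1) - deriv g1 (p $ 2)))
     / (2 * surf_W r p ^ 3)"
proof -
  \<comment> \<open>This makes the choice of index by SOME in \<open>surf_L\<close>
    irrelevant.\<close>
  have "d1 r 1 k p = 1" for k
    using exhaust_2[of k] by (auto simp: d1_translation_graphs)
  then have L: "surf_L r i j p =
      (d2 r 2 i j p * (deriv f2 (p $ 1) - deriv g2 (p $ 2))
       - d2 r 3 i j p * (deriv f1 (p $ 1) - deriv g1 (p $ 2))) / surf_W r p" for i j
    by (simp add: surf_L_def surf_L_wrt_def surf_N_def inner_vec_def sum_3 d1_translation_graphs
        d2_translation_graphs add_divide_distrib diff_divide_distrib algebra_simps)
  show ?thesis
    by (simp add: mean_curvature_def L d1_translation_graphs d2_translation_graphs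
        power2_eq_square power3_eq_cube algebra_simps flip: add_divide_distrib diff_divide_distrib)
qed

end

text \<open>Derivatives see only values near \<open>x\<close>. This serves to differentiate the
  identities for minimality, \<open>G w = c\<close> and \<open>P' u = 0\<close>.\<close>

lemma DERIV_unique_on_open:
  fixes f g :: "real \<Rightarrow> real"
  assumes "open S" "x \<in> S" "\<And>y. y \<in> S \<Longrightarrow> f y = g y"
    and "(f has_field_derivative D) (at x)" "(g has_field_derivative E) (at x)"
  shows "D = E"
  using DERIV_unique has_field_derivative_transform_within_open assms by metis

lemma minimal_translation_system_torsion_zero:
  fixes F F' F'' P P' P'' G G' :: "real \<Rightarrow> real"
  assumes I: "open I" "I \<noteq> {}" and J: "open J" "J \<noteq> {}"
    and F: "\<And>u. u \<in> I \<Longrightarrow> (F has_field_derivative F' u) (at u)"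
           "\<And>u. u \<in> I \<Longrightarrow> (F' has_field_derivative F'' u) (at u)"
    and P: "\<And>u. u \<in> I \<Longrightarrow> (P has_field_derivative P' u) (at u)"
           "\<And>u. u \<in> I \<Longrightarrow> (P' has_field_derivative P'' u) (at u)"
    and G: "\<And>v. v \<in> J \<Longrightarrow> (G has_field_derivative G' v) (at v)"
    and minimal: "\<And>u v. u \<in> I \<Longrightarrow> v \<in> J \<Longrightarrow> (F' u + G' v) * P u = P' u * (F u - G v)"
    and regular: "\<And>u v. u \<in> I \<Longrightarrow> v \<in> J \<Longrightarrow> P u \<noteq> 0 \<or> F u \<noteq> G v"
  shows "\<exists>u\<in>I. F' u * P'' u = F'' u * P' u"
proof -
  have minimal': "F'' u * P u + G' v * P' u = P'' u * (F u - G v)" if "u \<in> I" "v \<in> J" for u v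
  proof -
    \<comment> \<open>The two sides of minimality differentiated in \<open>u\<close>; the term
      \<open>F' u * P' u\<close> then cancels.\<close>
    have "F'' u * P u + P' u * (F' u + G' v) = P'' u * (F u - G v) + F' u * P' u"
    proof (rule DERIV_unique_on_open[OF I(1) that(1) minimal])
      show "((\<lambda>u. (F' u + G' v) * P u) has_field_derivative F'' u * P u + P' u * (F' u + G' v)) (at u)"
        by (rule derivative_eq_intros F P that refl | simp)+
      show "((\<lambda>u. P' u * (F u - G v)) has_field_derivative P'' u * (F u - G v) + F' u * P' u) (at u)"
        by (rule derivative_eq_intros F P that refl | simp)+
    qed (use that in auto)
    then show ?thesis by (simp add: algebra_simps)
  qed
  obtain v where v: "v \<in> J" using J by blast
  show ?thesis
  proof (cases "\<exists>u\<in>I. P u * P'' u \<noteq> (P' u)\<^sup>2")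
    case True
    then obtain u where u: "u \<in> I" and nz: "P u * P'' u - (P' u)\<^sup>2 \<noteq> 0" by auto
    \<comment> \<open>Solve for G in \<open>P u\<close> times \<open>minimal'\<close> minus
      \<open>P' u\<close> times \<open>minimal\<close>, where \<open>G'\<close> drops out. Only the
      fixed \<open>u\<close> remains.\<close>
    define c where "c = (P u * (P'' u * F u - F'' u * P u) - P' u * (P' u * F u - F' u * P u))
        / (P u * P'' u - (P' u)\<^sup>2)"
    have "G w = c" if "w \<in> J" for w
    proof -
      have "G w * (P u * P'' u - (P' u)\<^sup>2)
          = P u * (P'' u * F u - F'' u * P u) - P' u * (P' u * F u - F' u * P u)"
        using minimal[OF u that] minimal'[OF u that] by algebra
      with nz show ?thesis by (simp add: c_def eq_divide_eq)
    qed
    then have "G' v = 0"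
      by (intro DERIV_unique_on_open[OF J(1) v _ G[OF v] DERIV_const])
    then have "F' u * P'' u = F'' u * P' u"
      using minimal[OF u v] minimal'[OF u v] regular[OF u v] by algebra
    with u show ?thesis by blast
  next
    case False
    show ?thesis
    proof (cases "\<exists>u\<in>I. P u \<noteq> 0")
      case True
      then obtain u where u: "u \<in> I" and nz: "P u \<noteq> 0" by blast
      have "P u * P'' u = (P' u)\<^sup>2" using False u by blast
      \<comment> \<open>Multiplying \<open>minimal'\<close> by \<open>P u\<close> and comparing with
        \<open>P' u\<close> times \<open>minimal\<close> gives
        \<open>P u * F'' u = P' u * F' u\<close>. Multiply by \<open>P' u\<close>, replace its
        square and cancel \<open>P u\<close>.\<close>
      then have "F' u * P'' u = F'' u * P' u"
        using nz minimal[OF u v] minimal'[OF u v] by algebra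
      with u show ?thesis by blast
    next
      case P0: False
      have P'0: "P' u = 0" if "u \<in> I" for u
        using False P0 that by force
      have "P'' u = 0" if "u \<in> I" for u
        using DERIV_unique_on_open[OF I(1) that P'0 P(2)[OF that] DERIV_const] .
      with P'0 I(2) show ?thesis by auto
    qed
  qed
qed

lemma smooth_on_DERIV:
  assumes "smooth_on I f" "x \<in> I"
  shows "((deriv ^^ n) f has_field_derivative (deriv ^^ Suc n) f x) (at x)"
  using assms DERIV_deriv_iff_real_differentiable by (auto simp: smooth_on_def)

theorem theorem5p2:
  shows "\<not> (\<exists>(I :: real set) (J :: real set) (f1 :: real \<Rightarrow> real) (f2 :: real \<Rightarrow> real)
            (g :: real \<Rightarrow> real) (a :: real) (\<alpha> :: real \<Rightarrow> real^3) (\<beta> :: real \<Rightarrow> real^3)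
            (r :: real^2 \<Rightarrow> real^3) (D :: (real^2) set).
      open_interval I \<and> open_interval J \<and>
      smooth_on I f1 \<and> smooth_on I f2 \<and> smooth_on J g \<and>
      \<alpha> = (\<lambda>u. vector [u, f1 u, f2 u]) \<and> space_curve I \<alpha> \<and>
      \<beta> = (\<lambda>v. vector [v, g v, a * v]) \<and> planar_curve J \<beta> \<and> non_isotropic_curve J \<beta> \<and>
      r = translation_surface \<alpha> \<beta> \<and>
      D = {p. p $ 1 \<in> I \<and> p $ 2 \<in> J} \<and>
      admissible_on D r \<and> regular_on D r \<and> minimal_on D r)"
proof (rule notI, elim exE conjE)
  fix I J :: "real set" and f1 f2 g :: "real \<Rightarrow> real" and a :: real
    and \<alpha> \<beta> :: "real \<Rightarrow> real^3" and r :: "real^2 \<Rightarrow> real^3" and D :: "(real^2) set"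
  assume I: "open_interval I" and J: "open_interval J"
    and f1: "smooth_on I f1" and f2: "smooth_on I f2" and g: "smooth_on J g"
    and \<alpha>: "\<alpha> = (\<lambda>u. vector [u, f1 u, f2 u])" and space: "space_curve I \<alpha>"
    and \<beta>: "\<beta> = (\<lambda>v. vector [v, g v, a * v])"
    and r: "r = translation_surface \<alpha> \<beta>" and D: "D = {p. p $ 1 \<in> I \<and> p $ 2 \<in> J}"
    and reg: "regular_on D r" and min: "minimal_on D r"
  \<comment> \<open>Matching \<open>a * v\<close> with \<open>g2 v\<close> instantiates
    \<open>g2\<close> in this eta-contracted form.\<close>
  have a: "deriv ((*) a) = (\<lambda>v. a)"
    by (simp add: fun_eq_iff)
  have W: "surf_W r (vector [u, v]) = sqrt ((deriv f2 u - a)\<^sup>2 + (deriv f1 u - deriv g v)\<^sup>2)" for u v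
    by (simp add: r \<alpha> \<beta> surf_W_translation_graphs a)
  have Wpos: "surf_W r (vector [u, v]) > 0" if "u \<in> I" "v \<in> J" for u v
    using reg that by (simp add: regular_on_def D)
  have "\<exists>u\<in>I. (deriv ^^ 2) f1 u * (deriv ^^ 3) f2 u = (deriv ^^ 3) f1 u * (deriv ^^ 2) f2 u"
  proof (rule minimal_translation_system_torsion_zero)
    show "open I" "I \<noteq> {}" "open J" "J \<noteq> {}"
      using I J by (auto simp: open_interval_def)
    show "(deriv f1 has_field_derivative (deriv ^^ 2) f1 u) (at u)"
      "((deriv ^^ 2) f1 has_field_derivative (deriv ^^ 3) f1 u) (at u)" if "u \<in> I" for u
      using smooth_on_DERIV[OF f1 that, of 1] smooth_on_DERIV[OF f1 that, of 2]
      by (simp_all add: numeral_2_eq_2 numeral_3_eq_3)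
    \<comment> \<open>Subtracting \<open>a\<close> leaves the higher derivatives unchanged, so the
      determinant obtained is the torsion of \<alpha> itself.\<close>
    show "((\<lambda>u. deriv f2 u - a) has_field_derivative (deriv ^^ 2) f2 u) (at u)"
      "((deriv ^^ 2) f2 has_field_derivative (deriv ^^ 3) f2 u) (at u)" if "u \<in> I" for u
      using DERIV_diff[OF smooth_on_DERIV[OF f2 that, of 1] DERIV_const[of a]]
        smooth_on_DERIV[OF f2 that, of 2]
      by (simp_all add: numeral_2_eq_2 numeral_3_eq_3)
    show "(deriv g has_field_derivative (deriv ^^ 2) g v) (at v)" if "v \<in> J" for v
      using smooth_on_DERIV[OF g that, of 1] by (simp add: numeral_2_eq_2)
    show "((deriv ^^ 2) f1 u + (deriv ^^ 2) g v) * (deriv f2 u - a)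
        = (deriv ^^ 2) f2 u * (deriv f1 u - deriv g v)" if "u \<in> I" "v \<in> J" for u v
    proof -
      have "mean_curvature r (vector [u, v]) = 0"
        using min that by (simp add: minimal_on_def D)
      then show ?thesis
        using Wpos[OF that]
        by (simp add: r \<alpha> \<beta> mean_curvature_translation_graphs a numeral_2_eq_2)
    qed
    show "deriv f2 u - a \<noteq> 0 \<or> deriv f1 u \<noteq> deriv g v" if "u \<in> I" "v \<in> J" for u v
      using Wpos[OF that] by (auto simp: W)
  qed
  with space show False
    by (auto simp: space_curve_def \<alpha>)
qed

end
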